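(* For every odd integer \(m\ge 3\), the directed Cayley digraph \[ D_7(m)=\operatorname{Cay}\bigl((\mathbb Z_m)^7,\{e_0,e_1,\ldots,e_6\}\bigr) \] admits a directed Hamilton decomposition, i.e. its arc set can be partitioned into (seven) arc-disjoint directed Hamilton cycles.
   Context: \(e_0,\ldots,e_6\) denote the standard basis vectors of \((\mathbb Z_m)^7\). The Cayley digraph \(\operatorname{Cay}((\mathbb Z_m)^7,\{e_0,\ldots,e_6\})\) has vertex set \((\mathbb Z_m)^7\) and an arc \(x\to x+e_i\) for every vertex \(x\) and every \(i\in\{0,\ldots,6\}\). A directed Hamilton decomposition of a digraph is a partition of its arc set into directed Hamilton cycles. *)

theory Defs
  imports
    "HOL-Algebra.Elementary_Groups"
    "HOL-Algebra.Product_Groups"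
    "HOL-Library.Disjoint_Sets"
    "Graph_Theory.Arc_Walk"
begin

definition cayley_digraph :: "('a, 'b) monoid_scheme \<Rightarrow> 'a set \<Rightarrow> ('a, 'a \<times> 'a) pre_digraph" where
  "cayley_digraph G S =
     \<lparr>verts = carrier G,
      arcs = {(x, x \<otimes>\<^bsub>G\<^esub> s) | x s. x \<in> carrier G \<and> s \<in> S},
      tail = fst,
      head = snd\<rparr>"

text \<open>
  The group operation of \<^const>\<open>integer_mod_group\<close> \<open>m\<close>, written multiplicatively in HOL-Algebra,
  is addition modulo \<open>m\<close> on \<open>{0..<m}\<close> for \<open>m > 0\<close>.  A vector is an extensional function on
  the index set \<open>{..<d}\<close>.
\<close>
definition Zmod_power :: "nat \<Rightarrow> nat \<Rightarrow> (nat \<Rightarrow> int) monoid" where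
  "Zmod_power m d = product_group {..<d} (\<lambda>_. integer_mod_group m)"

text \<open>The entry \<open>1\<close> is a canonical representative only for \<open>m > 1\<close> (or \<open>m = 0\<close>).\<close>
definition std_basis :: "nat \<Rightarrow> nat \<Rightarrow> (nat \<Rightarrow> int)" where
  "std_basis d i = (\<lambda>j\<in>{..<d}. if j = i then 1 else 0)"

definition D7 :: "nat \<Rightarrow> (nat \<Rightarrow> int, (nat \<Rightarrow> int) \<times> (nat \<Rightarrow> int)) pre_digraph" where
  "D7 m = cayley_digraph (Zmod_power m 7) (std_basis 7 ` {..<7})"

text \<open>
  A cycle is a closed arc walk that repeats no vertex; as every vertex of a closed walk is the tail
  of one of its arcs, the second conjunct says that the cycle visits every vertex.
\<close>
definition hamilton_cycle :: "('a, 'b) pre_digraph \<Rightarrow> 'b awalk \<Rightarrow> bool" where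
  "hamilton_cycle G p \<longleftrightarrow> pre_digraph.cycle G p \<and> tail G ` set p = verts G"

definition hamilton_decomposition :: "('a, 'b) pre_digraph \<Rightarrow> 'b set set \<Rightarrow> bool" where
  "hamilton_decomposition G P \<longleftrightarrow>
     partition_on (arcs G) P \<and> (\<forall>C\<in>P. \<exists>p. hamilton_cycle G p \<and> set p = C)"

lemma std_basis_in_carrier:
  assumes "m > 1"
  shows "std_basis d i \<in> carrier (Zmod_power m d)"
  using assms by (auto simp: std_basis_def Zmod_power_def carrier_integer_mod_group)

lemma Zmod_power_add_std_basis:
  assumes "m > 1" "x \<in> carrier (Zmod_power m d)" "i < d"
  shows "x \<otimes>\<^bsub>Zmod_power m d\<^esub> std_basis d i = x(i := (x i + 1) mod int m)"
proof
  fix j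
  have "j < d \<Longrightarrow> x j \<in> {0..<int m}" "\<not> j < d \<Longrightarrow> x j = undefined"
    using assms by (auto simp: Zmod_power_def carrier_integer_mod_group PiE_def extensional_def)
  then show "(x \<otimes>\<^bsub>Zmod_power m d\<^esub> std_basis d i) j = (x(i := (x i + 1) mod int m)) j"
    using assms
    by (auto simp: std_basis_def Zmod_power_def integer_mod_group_def integer_group_def)
qed

lemma wf_digraph_D7:
  assumes "m > 1"
  shows "wf_digraph (D7 m)"
proof -
  have "group (Zmod_power m 7)"
    unfolding Zmod_power_def by simp
  then have "x \<otimes>\<^bsub>Zmod_power m 7\<^esub> std_basis 7 i \<in> carrier (Zmod_power m 7)"
    if "x \<in> carrier (Zmod_power m 7)" for x i
    using that std_basis_in_carrier[OF assms] by (simp add: group.is_monoid monoid.m_closed)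
  then show ?thesis
    by unfold_locales (auto simp: D7_def cayley_digraph_def)
qed

end

theory Submission
  imports Defs "HOL-Number_Theory.Cong"
begin

text \<open>
  At every vertex the seven outgoing arcs are distributed bijectively among seven colors, so that each
  color \<open>c\<close> moves \<open>x\<close> to \<open>x + e\<^sub>i\<close> for a direction \<open>i\<close> depending on \<open>c\<close> and \<open>x\<close>.  In the unimodular
  coordinates \<open>t = x\<^sub>0 + \<dots> + x\<^sub>6\<close>, \<open>y = x\<^sub>4 + x\<^sub>5 + x\<^sub>6\<close>, \<open>z = x\<^sub>0 + x\<^sub>1\<close>, \<open>x\<^sub>0\<close>, \<open>x\<^sub>2\<close>, \<open>x\<^sub>4\<close>, \<open>x\<^sub>5\<close>
  every color map is triangular: each coordinate is advanced by 0 or 1 according to the earlier ones.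
  Such a map is a generalized odometer, and it is a single cycle of length \<open>m\<^sup>7\<close> as soon as, for each
  coordinate, the total advance over all values of the earlier coordinates is a unit modulo \<open>m\<close>.
  The coloring only distinguishes \<open>t = 0\<close>, \<open>t = 1\<close>, \<open>t \<ge> 2\<close> and whether the other coordinates vanish,
  which makes these totals congruent to \<open>\<plusminus>1\<close>, \<open>\<plusminus>2\<close> or \<open>\<plusminus>4\<close> independently of \<open>m\<close>; as \<open>m\<close> is odd,
  they are units.
\<close>

section \<open>Residue tuples and generalized odometers\<close>

definition residue_lists :: "nat \<Rightarrow> nat \<Rightarrow> int list set" where
  "residue_lists m k = {u. set u \<subseteq> {0..<int m} \<and> length u = k}"

lemma finite_residue_lists: "finite (residue_lists m k)"
  by (simp add: residue_lists_def finite_lists_length_eq)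

lemma card_residue_lists: "card (residue_lists m k) = m ^ k"
  by (simp add: residue_lists_def card_lists_length_eq)

lemma residue_lists_0: "residue_lists m 0 = {[]}"
  by (auto simp: residue_lists_def)

lemma sum_residue_lists_Suc:
  "(\<Sum>u\<in>residue_lists m (Suc k). g u) = (\<Sum>t\<in>{0..<int m}. \<Sum>u\<in>residue_lists m k. g (t # u))"
proof -
  have eq: "residue_lists m (Suc k) = case_prod (#) ` ({0..<int m} \<times> residue_lists m k)"
    by (auto simp: residue_lists_def image_iff length_Suc_conv)
  have "inj_on (case_prod (#)) ({0..<int m} \<times> residue_lists m k)"
    by (auto simp: inj_on_def)
  then have "(\<Sum>u\<in>residue_lists m (Suc k). g u) =
      (\<Sum>(t, u)\<in>{0..<int m} \<times> residue_lists m k. g (t # u))"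
    unfolding eq by (subst sum.reindex) (auto intro!: sum.cong)
  then show ?thesis
    by (simp add: sum.cartesian_product)
qed

definition residues_of :: "nat \<Rightarrow> (nat \<Rightarrow> 'a \<Rightarrow> int) \<Rightarrow> nat \<Rightarrow> 'a \<Rightarrow> int list" where
  "residues_of m h k x = map (\<lambda>j. h j x mod int m) [0..<k]"

lemma residues_of_Suc: "residues_of m h (Suc k) x = residues_of m h k x @ [h k x mod int m]"
  by (simp add: residues_of_def)

lemma residues_of_in_residue_lists: "m > 0 \<Longrightarrow> residues_of m h k x \<in> residue_lists m k"
  by (auto simp: residues_of_def residue_lists_def)

text \<open>One function \<open>\<phi>\<close> serves all coordinates: its argument lists the
  residues of the earlier coordinates, so the length of the list tells which coordinate is being
  advanced.\<close>

locale odometer =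
  fixes m n :: nat and X :: "'a set" and f :: "'a \<Rightarrow> 'a"
    and h :: "nat \<Rightarrow> 'a \<Rightarrow> int" and \<phi> :: "int list \<Rightarrow> int"
  assumes m_pos: "m > 0"
    and closed: "x \<in> X \<Longrightarrow> f x \<in> X"
    and step: "\<lbrakk>k < n; x \<in> X\<rbrakk> \<Longrightarrow> [h k (f x) = h k x + \<phi> (residues_of m h k x)] (mod int m)"
    and unit: "k < n \<Longrightarrow> coprime (\<Sum>u\<in>residue_lists m k. \<phi> u) (int m)"
begin

lemma funpow_closed: "x \<in> X \<Longrightarrow> (f ^^ i) x \<in> X"
  by (induction i) (auto intro: closed)

lemma coordinate_funpow:
  assumes "k < n" "x \<in> X"
  shows "[h k ((f ^^ i) x) = h k x + (\<Sum>j<i. \<phi> (residues_of m h k ((f ^^ j) x)))] (mod int m)"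
proof (induction i)
  case (Suc i)
  have "[h k ((f ^^ Suc i) x) = h k ((f ^^ i) x) + \<phi> (residues_of m h k ((f ^^ i) x))] (mod int m)"
    using step[OF assms(1) funpow_closed[OF assms(2)]] by simp
  also have "[h k ((f ^^ i) x) + \<phi> (residues_of m h k ((f ^^ i) x)) =
      h k x + (\<Sum>j<i. \<phi> (residues_of m h k ((f ^^ j) x))) + \<phi> (residues_of m h k ((f ^^ i) x))]
      (mod int m)"
    using Suc by (intro cong_add) auto
  finally show ?case
    by (simp add: add.assoc)
qed simp

text \<open>Induction on \<open>k\<close>. By hypothesis \<open>m ^ k\<close> consecutive iterates
  have distinct residue lists, so by counting they meet each list once. Over such a period
  coordinate \<open>k\<close> therefore gains the total of \<open>\<phi>\<close>, a unit, and needs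
  exactly \<open>m\<close> periods to return.\<close>

lemma residues_of_funpow_eq_iff:
  "\<lbrakk>k \<le> n; x \<in> X\<rbrakk> \<Longrightarrow> residues_of m h k ((f ^^ i) x) = residues_of m h k x \<longleftrightarrow> m ^ k dvd i"
proof (induction k arbitrary: x i)
  case 0
  then show ?case by (simp add: residues_of_def)
next
  case (Suc k)
  define N where "N = m ^ k"
  define S where "S = (\<Sum>u\<in>residue_lists m k. \<phi> u)"
  have k: "k < n" and IH: "\<And>x i. x \<in> X \<Longrightarrow>
      residues_of m h k ((f ^^ i) x) = residues_of m h k x \<longleftrightarrow> N dvd i"
    using Suc by (auto simp: N_def)
  have period: "[h k ((f ^^ N) y) = h k y + S] (mod int m)" if "y \<in> X" for y
  proof -
    let ?r = "\<lambda>j. residues_of m h k ((f ^^ j) y)"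
    have "inj_on ?r {..<N}"
    proof (rule linorder_inj_onI')
      fix i j assume ij: "i \<in> {..<N}" "j \<in> {..<N}" "i < j"
      have "?r j = residues_of m h k ((f ^^ (j - i)) ((f ^^ i) y))"
        using ij by (simp flip: funpow_add comp_apply[of "f ^^ (j - i)"])
      moreover have "\<not> N dvd j - i"
        using ij by (auto dest: dvd_imp_le)
      ultimately show "?r i \<noteq> ?r j"
        using IH[OF funpow_closed[OF that]] by metis
    qed
    moreover have "?r ` {..<N} = residue_lists m k"
      using calculation m_pos
      by (intro card_subset_eq finite_residue_lists)
        (auto simp: card_image card_residue_lists N_def intro: residues_of_in_residue_lists)
    ultimately have "(\<Sum>j<N. \<phi> (?r j)) = S"
      unfolding S_def by (metis (mono_tags, lifting) sum.reindex_cong)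
    with coordinate_funpow[OF k that, of N] show ?thesis by simp
  qed
  have multiple: "[h k ((f ^^ (q * N)) x) = h k x + int q * S] (mod int m)" for q
  proof (induction q)
    case (Suc q)
    have "[h k ((f ^^ (Suc q * N)) x) = h k ((f ^^ (q * N)) x) + S] (mod int m)"
      using period[OF funpow_closed[OF \<open>x \<in> X\<close>]] by (simp add: funpow_add)
    also have "[h k ((f ^^ (q * N)) x) + S = h k x + int q * S + S] (mod int m)"
      using Suc by (intro cong_add) auto
    finally show ?case
      by (simp add: algebra_simps)
  qed simp
  show ?case
  proof (cases "N dvd i")
    case True
    then obtain q where q: "i = q * N" by (metis dvd_def mult.commute)
    have "residues_of m h (Suc k) ((f ^^ i) x) = residues_of m h (Suc k) x \<longleftrightarrow>
        [h k ((f ^^ i) x) = h k x] (mod int m)"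
      using IH[OF Suc.prems(2)] True by (simp add: residues_of_Suc cong_def)
    also have "\<dots> \<longleftrightarrow> [h k x + int q * S = h k x + 0] (mod int m)"
      using multiple[of q] unfolding q by (auto intro: cong_trans cong_sym)
    also have "\<dots> \<longleftrightarrow> int m dvd int q * S"
      by (simp only: cong_add_lcancel cong_0_iff)
    also have "\<dots> \<longleftrightarrow> int m dvd int q"
      using unit[OF k] by (simp add: S_def coprime_dvd_mult_left_iff coprime_commute)
    also have "\<dots> \<longleftrightarrow> m ^ Suc k dvd i"
      using m_pos by (simp add: q N_def)
    finally show ?thesis .
  next
    case False
    moreover have "\<not> m ^ Suc k dvd i"
      using False by (auto simp: N_def dest: dvd_mult_right)
    ultimately show ?thesis
      using IH[OF Suc.prems(2)] by (simp add: residues_of_Suc)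
  qed
qed

text \<open>Taking \<open>k = n\<close>, no point recurs before \<open>m ^ n\<close> steps;
  \<open>X\<close> has just that many points, so the orbit fills it.\<close>

lemma orbit:
  assumes "finite X" "card X = m ^ n" "x \<in> X"
  shows "inj_on (\<lambda>i. (f ^^ i) x) {..<m ^ n}"
    and "(\<lambda>i. (f ^^ i) x) ` {..<m ^ n} = X"
    and "(f ^^ (m ^ n)) x = x"
proof -
  have ne: "(f ^^ i) x \<noteq> (f ^^ j) x" if "i < j" "\<not> m ^ n dvd j - i" for i j
  proof -
    have "(f ^^ j) x = (f ^^ (j - i)) ((f ^^ i) x)"
      using that by (simp flip: funpow_add comp_apply[of "f ^^ (j - i)"])
    then show ?thesis
      using residues_of_funpow_eq_iff[OF order_refl funpow_closed[OF assms(3)]] that by metis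
  qed
  show inj: "inj_on (\<lambda>i. (f ^^ i) x) {..<m ^ n}"
  proof (rule linorder_inj_onI')
    fix i j assume ij: "i \<in> {..<m ^ n}" "j \<in> {..<m ^ n}" "i < j"
    then have "\<not> m ^ n dvd j - i"
      by (auto dest: dvd_imp_le)
    then show "(f ^^ i) x \<noteq> (f ^^ j) x"
      using ij by (intro ne)
  qed
  show img: "(\<lambda>i. (f ^^ i) x) ` {..<m ^ n} = X"
    using inj assms by (intro card_subset_eq) (auto simp: card_image intro: funpow_closed)
  \<comment> \<open>This iterate equals one of the first \<open>m ^ n\<close>. Were its index
    \<open>i\<close> positive, the residues would recur after \<open>m ^ n - i\<close> steps, which
    is too early.\<close>
  have "(f ^^ (m ^ n)) x \<in> X"
    using funpow_closed assms by simp
  then obtain i where i: "i < m ^ n" "(f ^^ (m ^ n)) x = (f ^^ i) x"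
    unfolding img[symmetric] by auto
  have "i = 0"
  proof (rule ccontr)
    assume "i \<noteq> 0"
    then have "\<not> m ^ n dvd m ^ n - i"
      using i by (auto dest: dvd_imp_le)
    then show False using ne[of i "m ^ n"] i by simp
  qed
  then show "(f ^^ (m ^ n)) x = x" using i by simp
qed

end

section \<open>Closed orbits as Hamilton cycles\<close>

lemma hamilton_cycle_orbit:
  assumes G: "tail G = fst" "head G = snd"
    and arcs: "\<And>v. v \<in> verts G \<Longrightarrow> (v, f v) \<in> arcs G"
    and x: "x \<in> verts G" and N: "N > 0" "(f ^^ N) x = x"
    and inj: "inj_on (\<lambda>i. (f ^^ i) x) {..<N}"
    and img: "(\<lambda>i. (f ^^ i) x) ` {..<N} = verts G"
  shows "\<exists>p. hamilton_cycle G p \<and> set p = (\<lambda>v. (v, f v)) ` verts G"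
proof -
  define arc where "arc = (\<lambda>v. (v, f v))"
  define p where "p = map (\<lambda>i. arc ((f ^^ i) x)) [0..<N]"
  interpret pre_digraph G .
  have upt: "[a..<a + Suc l] = a # [Suc a..<Suc a + l]" for a l
    by (simp add: upt_conv_Cons del: upt_Suc)
  have cas: "cas ((f ^^ a) x) (map (\<lambda>i. arc ((f ^^ i) x)) [a..<a + l]) ((f ^^ (a + l)) x)" for a l
  proof (induction l arbitrary: a)
    case (Suc l)
    then show ?case
      using Suc[of "Suc a"] unfolding upt by (simp add: G arc_def)
  qed simp
  have verts: "awalk_verts ((f ^^ a) x) (map (\<lambda>i. arc ((f ^^ i) x)) [a..<a + l]) =
      map (\<lambda>i. (f ^^ i) x) [a..<a + Suc l]" for a l
  proof (induction l arbitrary: a)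
    case (Suc l)
    then show ?case
      using Suc[of "Suc a"] unfolding upt by (simp add: G arc_def del: upt_Suc)
  qed simp
  have set_p: "set p = arc ` verts G"
    unfolding p_def img[symmetric] by (auto simp: lessThan_atLeast0)
  \<comment> \<open>\<open>cycle\<close> requires distinctness only after the first vertex:
    \<open>x\<close> at index 0 is dropped and its second occurrence, at index \<open>N\<close>, is
    kept.\<close>
  have "distinct (map (\<lambda>i. (f ^^ i) x) [Suc 0..<Suc N])"
  proof -
    have "x \<notin> (\<lambda>i. (f ^^ i) x) ` {Suc 0..<N}"
      using inj_onD[OF inj, of 0] N by fastforce
    moreover have "inj_on (\<lambda>i. (f ^^ i) x) {Suc 0..<N}"
      using inj by (rule inj_on_subset) auto
    ultimately show ?thesis
      using N by (simp add: distinct_map)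
  qed
  moreover have "awalk_verts x p = map (\<lambda>i. (f ^^ i) x) (0 # [Suc 0..<Suc N])"
    using verts[of 0 N] upt[of 0 N] by (simp add: p_def del: upt_Suc)
  ultimately have "distinct (tl (awalk_verts x p))"
    by simp
  moreover have "awalk x p x"
    using cas[of 0 N] x N arcs set_p by (auto simp: awalk_def p_def arc_def)
  ultimately have "cycle p"
    using N by (auto simp: cycle_def p_def)
  moreover have "tail G ` set p = verts G"
    by (simp add: set_p G arc_def image_image)
  ultimately show ?thesis
    unfolding hamilton_cycle_def using set_p arc_def by metis
qed

section \<open>The coloring of the arcs\<close>

text \<open>
  Entry \<open>i\<close> of the list is the color using direction \<open>i\<close>; the Boolean arguments say that the
  coordinate of that name is zero.  The set of colors using directions 4, 5, 6 depends on \<open>t\<close> only,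
  the set using directions 0, 1 on \<open>t\<close> and \<open>y\<close> only, and so on; this makes the color maps triangular.
  The individual colors were chosen so that \<open>advance_weights\<close> holds.
\<close>
definition hue :: "int \<Rightarrow> bool \<Rightarrow> bool \<Rightarrow> bool \<Rightarrow> bool \<Rightarrow> bool \<Rightarrow> nat list" where
  "hue t y z x0 x2 x4 =
    (let (c0, c1, c2, c3) =
       (if t = 0 then if y then (3, 6, 2, 5) else (2, 5, 3, 6)
        else if t = 1 then if y then (1, 6, 0, 4) else (0, 4, 1, 6)
        else (0, 2, 1, 3));
      a = y \<and> z \<and> x0 \<and> x2; b = \<not> y \<and> \<not> z \<and> x0 \<and> x2;
      (c4, c5, c6) =
       (if t = 0 then if a then (1, 0, 4) else (0, 4, 1)
        else if t = 1 then if a then (3, 2, 5) else (2, 5, 3)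
        else if a then (4, 6, 5) else if b then (5, 6, 4) else (6, 4, 5))
     in (if z then [c1, c0] else [c0, c1]) @ (if z \<and> x0 then [c3, c2] else [c2, c3]) @
        [c4] @ (if x4 then [c6, c5] else [c5, c6]))"

text \<open>Missing coordinates count as zero, so that a prefix of the coordinate list determines a palette.\<close>
definition palette :: "int list \<Rightarrow> nat list" where
  "palette u =
    (let zero = (\<lambda>i. i < length u \<longrightarrow> u ! i = 0)
     in hue (if u = [] then 0 else u ! 0) (zero 1) (zero 2) (zero 3) (zero 4) (zero 5))"

definition direction :: "nat \<Rightarrow> int list \<Rightarrow> nat" where
  "direction c u = length (takeWhile (\<lambda>d. d \<noteq> c) (palette u))"

text \<open>The \<open>k\<close>-th coordinate is the sum of the entries of \<open>x\<close> over \<open>block k\<close>.\<close>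
definition block :: "nat \<Rightarrow> nat set" where
  "block k = [{0..<7}, {4, 5, 6}, {0, 1}, {0}, {2}, {4}, {5}] ! k"

text \<open>A step in direction \<open>i\<close> raises the coordinate of \<open>block k\<close> by
  1 exactly if \<open>i\<close> lies in that block; as in \<open>odometer\<close>, the length of
  \<open>u\<close> is the index of the coordinate.\<close>

definition advance :: "nat \<Rightarrow> int list \<Rightarrow> int" where
  "advance c u = of_bool (direction c u \<in> block (length u))"

text \<open>
  If \<open>g\<close> only depends on which entries vanish, the value 1 stands for \<open>m - 1\<close> residues and therefore
  has weight \<open>-1\<close> modulo \<open>m\<close>.
\<close>
fun bsum :: "nat \<Rightarrow> (int list \<Rightarrow> int) \<Rightarrow> int" where
  "bsum 0 g = g []"
| "bsum (Suc k) g = bsum k (\<lambda>u. g (0 # u)) - bsum k (\<lambda>u. g (1 # u))"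


section \<open>Total advances modulo m\<close>

lemma sum_residue_lists_cong_bsum:
  assumes "m \<ge> 2"
    and "\<And>u v. list_all2 (\<lambda>a b. a = 0 \<longleftrightarrow> b = 0) u v \<Longrightarrow> g u = g v"
  shows "[(\<Sum>u\<in>residue_lists m k. g u) = bsum k g] (mod int m)"
  using assms(2)
proof (induction k arbitrary: g)
  case 0
  show ?case by (simp add: residue_lists_0)
next
  case (Suc k)
  define A where "A = (\<lambda>t. \<Sum>u\<in>residue_lists m k. g (t # u))"
  have A: "[A t = bsum k (\<lambda>u. g (t # u))] (mod int m)" for t
    unfolding A_def by (rule Suc.IH) (auto intro: Suc.prems)
  have "A t = A 1" if "t \<in> {1..<int m}" for t
    unfolding A_def using that by (intro sum.cong Suc.prems) (auto simp: list_all2_same)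
  then have "(\<Sum>t\<in>{1..<int m}. A t) = (\<Sum>t\<in>{1..<int m}. A 1)"
    by (rule sum.cong[OF refl])
  then have "(\<Sum>t\<in>{1..<int m}. A t) = (int m - 1) * A 1"
    using assms(1) by simp
  moreover have "{0..<int m} = insert 0 {1..<int m}"
    using assms(1) by auto
  ultimately have "(\<Sum>u\<in>residue_lists m (Suc k). g u) = A 0 - A 1 + int m * A 1"
    by (simp add: sum_residue_lists_Suc A_def algebra_simps)
  also have "[\<dots> = A 0 - A 1] (mod int m)"
    by (simp add: cong_iff_dvd_diff)
  also have "[A 0 - A 1 = bsum (Suc k) g] (mod int m)"
    using A by (simp add: cong_diff)
  finally show ?case .
qed

text \<open>The first entry is split three ways instead of two: the \<open>m - 2\<close> residues
  from 2 on contribute equally, which gives the weight -2.\<close>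

lemma sum_residue_lists_Suc_cong_bsum:
  assumes m: "m \<ge> 2"
    and zero: "\<And>t u v. list_all2 (\<lambda>a b. a = 0 \<longleftrightarrow> b = 0) u v \<Longrightarrow> g (t # u) = g (t # v)"
    and two: "\<And>t u. t \<ge> 2 \<Longrightarrow> g (t # u) = g (2 # u)"
  shows "[(\<Sum>u\<in>residue_lists m (Suc k). g u) =
    bsum k (\<lambda>u. g (0 # u)) + bsum k (\<lambda>u. g (1 # u)) - 2 * bsum k (\<lambda>u. g (2 # u))] (mod int m)"
proof -
  define A where "A = (\<lambda>t. \<Sum>u\<in>residue_lists m k. g (t # u))"
  have A: "[A t = bsum k (\<lambda>u. g (t # u))] (mod int m)" for t
    unfolding A_def using m zero by (intro sum_residue_lists_cong_bsum)
  have "A t = A 2" if "t \<in> {2..<int m}" for t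
    unfolding A_def using that two[of t] by simp
  then have "(\<Sum>t\<in>{2..<int m}. A t) = (\<Sum>t\<in>{2..<int m}. A 2)"
    by (rule sum.cong[OF refl])
  then have "(\<Sum>t\<in>{2..<int m}. A t) = (int m - 2) * A 2"
    using m by simp
  moreover have "{0..<int m} = insert 0 (insert 1 {2..<int m})"
    using m by auto
  ultimately have "(\<Sum>u\<in>residue_lists m (Suc k). g u) = A 0 + A 1 - 2 * A 2 + int m * A 2"
    by (simp add: sum_residue_lists_Suc A_def algebra_simps)
  also have "[\<dots> = A 0 + A 1 - 2 * A 2] (mod int m)"
    by (simp add: cong_iff_dvd_diff)
  also have "[A 0 + A 1 - 2 * A 2 =
    bsum k (\<lambda>u. g (0 # u)) + bsum k (\<lambda>u. g (1 # u)) - 2 * bsum k (\<lambda>u. g (2 # u))] (mod int m)"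
    by (intro cong_diff cong_add cong_mult A cong_refl)
  finally show ?thesis .
qed

text \<open>Reduces claims about all integers \<open>t\<close> to the values 0, 1, 2, where
  evaluation decides them.\<close>

lemma hue_reduce: "hue t = hue (if t = 0 then 0 else if t = 1 then 1 else 2)"
  by (intro ext) (simp add: hue_def)

lemma distinct_hue: "distinct (hue t y z x0 x2 x4)"
  and set_hue: "set (hue t y z x0 x2 x4) = {0..<7}"
proof -
  have "\<forall>t\<in>set [0, 1, 2]. \<forall>y z x0 x2 x4.
      distinct (hue t y z x0 x2 x4) \<and> set (hue t y z x0 x2 x4) = {0..<7}"
    by code_simp
  then show "distinct (hue t y z x0 x2 x4)" "set (hue t y z x0 x2 x4) = {0..<7}"
    by (subst hue_reduce, simp)+
qed

lemma distinct_palette: "distinct (palette u)"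
  and set_palette: "set (palette u) = {0..<7}"
  by (simp_all add: palette_def Let_def distinct_hue set_hue)

lemma length_palette: "length (palette u) = 7"
  using distinct_card[OF distinct_palette] by (simp add: set_palette)

lemma direction_less:
  assumes "c < 7"
  shows "direction c u < 7"
proof (rule ccontr)
  assume "\<not> direction c u < 7"
  then have "takeWhile (\<lambda>d. d \<noteq> c) (palette u) = palette u"
    unfolding direction_def length_palette[of u, symmetric]
    by (metis takeWhile_eq_take take_all not_less)
  then show False
    using assms by (auto simp: takeWhile_eq_all_conv set_palette)
qed

lemma palette_direction: "c < 7 \<Longrightarrow> palette u ! direction c u = c"
  using nth_length_takeWhile[of "\<lambda>d. d \<noteq> c" "palette u"] direction_less[of c u]
  by (simp add: direction_def length_palette)

lemma direction_palette:
  assumes "i < 7"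
  shows "palette u ! i < 7" "direction (palette u ! i) u = i"
proof -
  show less: "palette u ! i < 7"
    using nth_mem[of i "palette u"] assms by (simp add: length_palette set_palette)
  show "direction (palette u ! i) u = i"
    using palette_direction[OF less] direction_less[OF less] assms distinct_palette[of u]
    by (metis nth_eq_iff_index_eq length_palette)
qed

text \<open>The combination is the total advance of coordinate \<open>k + 1\<close> modulo
  \<open>m\<close>. It does not mention \<open>m\<close>, so one finite evaluation settles all
  moduli.\<close>

lemma advance_weights: "\<forall>c\<in>set [0..<7]. \<forall>k\<in>set [0..<6].
   bsum k (\<lambda>u. advance c (0 # u)) + bsum k (\<lambda>u. advance c (1 # u))
     - 2 * bsum k (\<lambda>u. advance c (2 # u)) \<in> {1, -1, 2, -2, 4, -4}"
  by code_simp

lemma coprime_sum_advance: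
  assumes "odd m" "m \<ge> 2" "c < 7" "k < 7"
  shows "coprime (\<Sum>u\<in>residue_lists m k. advance c u) (int m)"
proof (cases k)
  \<comment> \<open>Coordinate 0 is the sum of all entries, so every step advances it by 1.\<close>
  case 0
  then show ?thesis
    using direction_less[OF assms(3), of "[]"] by (simp add: residue_lists_0 advance_def block_def)
next
  case (Suc l)
  define w where "w = bsum l (\<lambda>u. advance c (0 # u)) + bsum l (\<lambda>u. advance c (1 # u))
     - 2 * bsum l (\<lambda>u. advance c (2 # u))"
  have "[(\<Sum>u\<in>residue_lists m k. advance c u) = w] (mod int m)"
    unfolding w_def Suc
  proof (rule sum_residue_lists_Suc_cong_bsum)
    fix t :: int and u v assume uv: "list_all2 (\<lambda>(a :: int) (b :: int). a = 0 \<longleftrightarrow> b = 0) u v"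
    then have "palette (t # u) = palette (t # v)"
      by (auto simp: palette_def Let_def list_all2_conv_all_nth
          intro!: arg_cong2[of _ _ _ _ "hue t _ _ _"])
    then show "advance c (t # u) = advance c (t # v)"
      using list_all2_lengthD[OF uv] by (simp add: advance_def direction_def)
  next
    fix t :: int and u assume "t \<ge> 2"
    then have "hue t = hue 2"
      by (subst hue_reduce) simp
    then have "palette (t # u) = palette (2 # u)"
      by (simp add: palette_def Let_def)
    then show "advance c (t # u) = advance c (2 # u)"
      by (simp add: advance_def direction_def)
  qed fact
  moreover have "coprime w (int m)"
  proof -
    have "coprime (2 ^ j) (int m)" for j
      using assms(1) by simp
    from this[of 1] this[of 2] have "coprime 2 (int m)" "coprime 4 (int m)"
      by simp_all
    moreover have "w \<in> {1, -1, 2, -2, 4, -4}"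
      unfolding w_def using advance_weights assms Suc by auto
    ultimately show ?thesis by auto
  qed
  ultimately show ?thesis
    by (metis cong_imp_coprime cong_sym)
qed

text \<open>This is the triangularity: whether coordinate \<open>k\<close> advances is already
  decided by the coordinates before it.\<close>

lemma direction_take:
  assumes "length u = 6" "k < 7" "c < 7"
  shows "direction c (take k u) \<in> block k \<longleftrightarrow> direction c u \<in> block k"
proof -
  \<comment> \<open>\<open>True\<close> replaces the coordinates cut off, since
    \<open>palette\<close> counts missing ones as zero. Block 0 holds all directions, and for block
    6 nothing is cut off.\<close>
  have *: "\<forall>t\<in>set [0, 1, 2]. \<forall>y z x0 x2 x4. \<forall>c\<in>set [0..<7].
      let D = (\<lambda>L. length (takeWhile (\<lambda>d. d \<noteq> c) L)); E = D (hue t y z x0 x2 x4)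
      in (D (hue t True True True True True) \<in> block 1 \<longleftrightarrow> E \<in> block 1) \<and>
         (D (hue t y True True True True) \<in> block 2 \<longleftrightarrow> E \<in> block 2) \<and>
         (D (hue t y z True True True) \<in> block 3 \<longleftrightarrow> E \<in> block 3) \<and>
         (D (hue t y z x0 True True) \<in> block 4 \<longleftrightarrow> E \<in> block 4) \<and>
         (D (hue t y z x0 x2 True) \<in> block 5 \<longleftrightarrow> E \<in> block 5)"
    by code_simp
  obtain t y z x0 x2 x4 where u: "u = [t, y, z, x0, x2, x4]"
    using assms(1) by (auto simp: numeral_eq_Suc length_Suc_conv)
  consider "k = 0" | "k = 1" | "k = 2" | "k = 3" | "k = 4" | "k = 5" | "k = 6"
    using assms(2) by linarith
  then show ?thesis
  proof cases
    case 1
    then show ?thesis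
      using direction_less[OF assms(3)] by (simp add: block_def)
  qed (use *[rule_format, of "if t = 0 then 0 else if t = 1 then 1 else 2" c
        "y = 0" "z = 0" "x0 = 0" "x2 = 0" "x4 = 0"] assms(3)
    in \<open>simp_all add: u direction_def palette_def Let_def flip: hue_reduce\<close>)
qed

section \<open>The color maps as odometers\<close>

definition block_sum :: "nat \<Rightarrow> (nat \<Rightarrow> int) \<Rightarrow> int" where
  "block_sum k x = (\<Sum>i\<in>block k. x i)"

text \<open>Six residues are taken because no palette consults the last coordinate.\<close>

definition arc_direction :: "nat \<Rightarrow> nat \<Rightarrow> (nat \<Rightarrow> int) \<Rightarrow> nat" where
  "arc_direction m c x = direction c (residues_of m block_sum 6 x)"

definition color_succ :: "nat \<Rightarrow> nat \<Rightarrow> (nat \<Rightarrow> int) \<Rightarrow> nat \<Rightarrow> int" where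
  "color_succ m c x = x \<otimes>\<^bsub>Zmod_power m 7\<^esub> std_basis 7 (arc_direction m c x)"

lemma carrier_Zmod_power: "m > 0 \<Longrightarrow> carrier (Zmod_power m d) = {..<d} \<rightarrow>\<^sub>E {0..<int m}"
  by (simp add: Zmod_power_def carrier_integer_mod_group)

lemma block_sum_update:
  assumes "k < 7"
  shows "[block_sum k (x(i := (x i + 1) mod int m)) = block_sum k x + of_bool (i \<in> block k)]
    (mod int m)"
proof -
  have fin: "finite (block k)"
    using assms by (auto simp: block_def numeral_eq_Suc less_Suc_eq)
  have "[block_sum k (x(i := (x i + 1) mod int m)) = (\<Sum>j\<in>block k. x j + of_bool (j = i))] (mod int m)"
    unfolding block_sum_def by (rule cong_sum) auto
  also have "(\<Sum>j\<in>block k. x j + of_bool (j = i)) = block_sum k x + of_bool (i \<in> block k)"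
    using fin by (simp add: sum.distrib block_sum_def of_bool_def)
  finally show ?thesis .
qed

lemma odometer_color_succ:
  assumes "odd m" "m \<ge> 2" "c < 7"
  shows "odometer m 7 (carrier (Zmod_power m 7)) (color_succ m c) block_sum (advance c)"
proof
  show "m > 0" using assms by simp
  fix x assume x: "x \<in> carrier (Zmod_power m 7)"
  have less: "arc_direction m c x < 7"
    unfolding arc_direction_def using assms(3) by (rule direction_less)
  have succ: "color_succ m c x = x(arc_direction m c x := (x (arc_direction m c x) + 1) mod int m)"
    unfolding color_succ_def using assms x less by (intro Zmod_power_add_std_basis) auto
  show "color_succ m c x \<in> carrier (Zmod_power m 7)"
    unfolding succ using x less assms by (auto simp: carrier_Zmod_power PiE_iff extensional_def)
  fix k :: nat assume k: "k < 7"
  have "residues_of m block_sum k x = take k (residues_of m block_sum 6 x)"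
    using k by (simp add: residues_of_def take_map)
  then have "advance c (residues_of m block_sum k x) = of_bool (arc_direction m c x \<in> block k)"
    using direction_take[of "residues_of m block_sum 6 x" k c] k assms(3)
    by (simp add: advance_def arc_direction_def residues_of_def)
  then show "[block_sum k (color_succ m c x) =
      block_sum k x + advance c (residues_of m block_sum k x)] (mod int m)"
    using block_sum_update[OF k] by (simp add: succ)
next
  fix k :: nat assume "k < 7"
  then show "coprime (\<Sum>u\<in>residue_lists m k. advance c u) (int m)"
    using assms by (intro coprime_sum_advance)
qed

section \<open>Partition of the arcs into color classes\<close>

lemma inj_on_add_std_basis:
  assumes "m > 1" "x \<in> carrier (Zmod_power m d)"
  shows "inj_on (\<lambda>i. x \<otimes>\<^bsub>Zmod_power m d\<^esub> std_basis d i) {..<d}"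
proof (rule inj_onI)
  fix i j assume ij: "i \<in> {..<d}" "j \<in> {..<d}"
    and eq: "x \<otimes>\<^bsub>Zmod_power m d\<^esub> std_basis d i = x \<otimes>\<^bsub>Zmod_power m d\<^esub> std_basis d j"
  show "i = j"
  proof (rule ccontr)
    assume "i \<noteq> j"
    then have "[x i + 1 = x i] (mod int m)"
      using fun_cong[OF eq, of i] assms ij
      by (simp add: Zmod_power_add_std_basis cong_def) (metis mod_mod_trivial)
    then show False
      using assms(1) by (simp add: cong_iff_dvd_diff)
  qed
qed

theorem theorem1p1:
  fixes m :: nat
  assumes "odd m" and "m \<ge> 3"
  shows "\<exists>P. hamilton_decomposition (D7 m) P \<and> card P = 7"
proof -
  define V where "V = carrier (Zmod_power m 7)"
  define C where "C = (\<lambda>c. (\<lambda>x. (x, color_succ m c x)) ` V)"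
  have m: "m > 1" "m \<ge> 2" using assms by auto
  have D7: "verts (D7 m) = V" "tail (D7 m) = fst" "head (D7 m) = snd"
    "arcs (D7 m) = {(x, x \<otimes>\<^bsub>Zmod_power m 7\<^esub> s) | x s. x \<in> V \<and> s \<in> std_basis 7 ` {..<7}}"
    by (auto simp: D7_def cayley_digraph_def V_def)
  have V: "finite V" "card V = m ^ 7"
    using m by (simp_all add: V_def carrier_Zmod_power card_PiE finite_PiE)
  moreover have "(0::nat) < m ^ 7"
    using m by simp
  ultimately obtain x where x: "x \<in> V"
    by (metis card.empty ex_in_conv less_irrefl)
  have arc: "(v, color_succ m c v) \<in> arcs (D7 m)" if "c < 7" "v \<in> V" for c v
    using that direction_less[OF that(1)] by (auto simp: D7 color_succ_def arc_direction_def)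
  have cycle: "\<exists>p. hamilton_cycle (D7 m) p \<and> set p = C c" if "c < 7" for c
  proof -
    interpret odometer m 7 V "color_succ m c" block_sum "advance c"
      unfolding V_def using assms(1) m(2) that by (rule odometer_color_succ)
    show ?thesis
      unfolding C_def using orbit[OF V x] arc[OF that] x m
      by (fold D7(1), intro hamilton_cycle_orbit[where N = "m ^ 7" and x = x]) (auto simp: D7)
  qed
  have disj: "C c \<inter> C d = {}" if "c < 7" "d < 7" "c \<noteq> d" for c d
  proof -
    \<comment> \<open>A common head would mean a common direction, where the palette at
      \<open>v\<close> has a single color.\<close>
    have "color_succ m c v \<noteq> color_succ m d v" if "v \<in> V" for v
    proof
      assume "color_succ m c v = color_succ m d v"
      then have "arc_direction m c v = arc_direction m d v"
        using inj_onD[OF inj_on_add_std_basis[OF m(1), of v 7]] that \<open>c < 7\<close> \<open>d < 7\<close>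
        by (simp add: V_def color_succ_def arc_direction_def direction_less)
      then show False
        using palette_direction \<open>c < 7\<close> \<open>d < 7\<close> \<open>c \<noteq> d\<close> by (metis arc_direction_def)
    qed
    then show ?thesis by (auto simp: C_def)
  qed
  \<comment> \<open>Disjoint classes are distinct once they are nonempty, so there are exactly
    seven.\<close>
  have ne: "C c \<noteq> {}" for c
    using x by (auto simp: C_def)
  have "inj_on C {..<7}"
    using disj ne by (intro inj_onI) (metis Int_absorb lessThan_iff)
  then have "card (C ` {..<7}) = 7"
    by (simp add: card_image)
  moreover have "partition_on (arcs (D7 m)) (C ` {..<7})"
  proof (rule partition_onI)
    show "\<Union> (C ` {..<7}) = arcs (D7 m)"
    proof
      show "\<Union> (C ` {..<7}) \<subseteq> arcs (D7 m)"
        using arc by (auto simp: C_def)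
      show "arcs (D7 m) \<subseteq> \<Union> (C ` {..<7})"
      proof
        fix e assume "e \<in> arcs (D7 m)"
        then obtain v i where e: "e = (v, v \<otimes>\<^bsub>Zmod_power m 7\<^esub> std_basis 7 i)" "v \<in> V" "i < 7"
          by (auto simp: D7)
        \<comment> \<open>The color of an arc is the entry for its direction in the palette at its
          tail.\<close>
        define c where "c = palette (residues_of m block_sum 6 v) ! i"
        have "c < 7" "arc_direction m c v = i"
          unfolding c_def arc_direction_def using e(3) by (simp_all add: direction_palette)
        then show "e \<in> \<Union> (C ` {..<7})"
          using e by (auto simp: C_def color_succ_def)
      qed
    qed
  next
    fix p q assume "p \<in> C ` {..<7}" "q \<in> C ` {..<7}" "p \<noteq> q"
    then show "disjnt p q"
      using disj by (auto simp: disjnt_def)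
  next
    show "{} \<notin> C ` {..<7}"
      using ne by auto
  qed
  ultimately show ?thesis
    unfolding hamilton_decomposition_def using cycle by blast
qed

end
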